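(* Let $(|\psi\rangle,\mathcal{S}_{\rm mutd},M)$ be a change point problem for an $n$-partite system, with $\mathcal{S}_{\rm mutd}=\{|\phi_1\rangle,\dots,|\phi_{d-1}\rangle\}$. Then the change point problem is locally solvable by an adaptive strategy if and only if the set $\mathcal{S}=\{|\psi\rangle\}\cup\mathcal{S}_{\rm mutd}$ admits partial local random authentication at least for the question $\mathcal{Q}_\psi$, i.e. the question "is the shared state (from $\mathcal{S}$) $|\psi\rangle$ or not?" can be perfectly answered under LOCC.
   Context: An $n$-partite system ($n\ge 2$) has Hilbert space $\bigotimes_{k=1}^n\mathbb{C}^{d_k}$, each tensor factor being held by a different spatially separated party. LOCC has its standard meaning: a protocol with finitely many rounds of local quantum measurements by individual parties and classical communication among all of them; a POVM is LOCC-implementable if its outcome statistics are produced by such a protocol (including classical post-processing). Authentication: for a set $\mathcal{S}$ of mutually orthogonal pure states and $|\psi\rangle\in\mathcal{S}$, the question $\mathcal{Q}_\psi$ can be perfectly answered under LOCC if there is a two-outcome LOCC-implementable POVM $\{M^{(0)},M^{(1)}\}$ with $\langle\psi|M^{(1)}|\psi\rangle=1$ and $\langle\phi|M^{(1)}|\phi\rangle=0$ for all $|\phi\rangle\in\mathcal{S}\setminus\{|\psi\rangle\}$. Change point problem: a triplet $(|\psi\rangle,\mathcal{S}_{\rm mutd},M)$, where $M\ge1$, $d\ge 2$, and $|\psi\rangle,|\phi_1\rangle,\dots,|\phi_{d-1}\rangle$ are mutually orthonormal pure states of the $n$-partite system spanning a $d$-dimensional space, $\mathcal{S}_{\rm mutd}=\{|\phi_1\rangle,\dots,|\phi_{d-1}\rangle\}$.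 A device emits a sequence of $M$ copies of the $n$-partite system; it is meant to prepare $|\psi\rangle$ but from some unknown point on it produces states drawn uniformly from $\mathcal{S}_{\rm mutd}$. Thus the parties share one of the states $$\rho_k=|\psi\rangle\langle\psi|^{\otimes k}\otimes\Big(\tfrac{1}{d-1}\mathbb{I}_{\mathcal{S}}\Big)^{\otimes(M-k)},\qquad k\in\{0,1,\dots,M\},$$ where $\mathbb{I}_{\mathcal{S}}$ is the orthogonal projector onto the span of $\mathcal{S}_{\rm mutd}$; each party holds its subsystem of each of the $M$ copies. The task is to determine $k$. Local adaptive strategy: a sequential LOCC protocol in which the $j$th copy of the $n$-partite system is measured individually, by an LOCC protocol acting on that copy only, for $j=1,2,\dots,M$ in turn; the LOCC measurement at step $j$ may depend on the classical outcomes of all steps $l<j$. The change point problem is locally solvable by an adaptive strategy if some local adaptive strategy identifies $k$ with certainty for every $k\in\{0,\dots,M\}$. *)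

theory Defs
  imports "Jordan_Normal_Form.Schur_Decomposition" "Jordan_Normal_Form.VS_Connect"
begin

section \<open>Linear algebra of finite-dimensional quantum systems\<close>

text \<open>
  A system with Hilbert space \<open>\<complex>\<^sup>D\<close> has its vectors in \<^term>\<open>carrier_vec D\<close> and its operators in
  \<^term>\<open>carrier_mat D D\<close>. The scalar product \<^term>\<open>v \<bullet>c w\<close> conjugates its \<^emph>\<open>second\<close> argument, so
  the physicists' \<open>\<langle>w|v\<rangle>\<close> is \<^term>\<open>v \<bullet>c w\<close>.
\<close>

definition trace :: "complex mat \<Rightarrow> complex" where
  "trace A = (\<Sum>i<dim_row A. A $$ (i, i))"

text \<open>In the order on complex numbers used here, \<open>0 \<le> z\<close> means that \<open>z\<close> is real and nonnegative.\<close>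

definition positive_op :: "nat \<Rightarrow> complex mat \<Rightarrow> bool" where
  "positive_op D A \<longleftrightarrow>
     A \<in> carrier_mat D D \<and> (\<forall>v \<in> carrier_vec D. 0 \<le> (A *\<^sub>v v) \<bullet>c v)"

definition density_op :: "nat \<Rightarrow> complex mat \<Rightarrow> bool" where
  "density_op D \<rho> \<longleftrightarrow> positive_op D \<rho> \<and> trace \<rho> = 1"

definition expect :: "complex mat \<Rightarrow> complex vec \<Rightarrow> complex" where
  "expect A \<psi> = (A *\<^sub>v \<psi>) \<bullet>c \<psi>"

definition ket_bra :: "complex vec \<Rightarrow> complex mat" where
  "ket_bra \<psi> = mat (dim_vec \<psi>) (dim_vec \<psi>) (\<lambda>(i, j). \<psi> $ i * cnj (\<psi> $ j))"

definition kron :: "complex mat \<Rightarrow> complex mat \<Rightarrow> complex mat" where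
  "kron A B = mat (dim_row A * dim_row B) (dim_col A * dim_col B)
     (\<lambda>(i, j). A $$ (i div dim_row B, j div dim_col B) * B $$ (i mod dim_row B, j mod dim_col B))"

definition kron_list :: "complex mat list \<Rightarrow> complex mat" where
  "kron_list As = foldr kron As (1\<^sub>m 1)"

definition vec_span :: "nat \<Rightarrow> complex vec set \<Rightarrow> complex vec set" where
  "vec_span D W = LinearCombinations.module.span class_ring (module_vec TYPE(complex) D) W"

definition is_orth_proj :: "nat \<Rightarrow> complex vec set \<Rightarrow> complex mat \<Rightarrow> bool" where
  "is_orth_proj D W P \<longleftrightarrow>
     P \<in> carrier_mat D D \<and> mat_adjoint P = P \<and> P * P = P \<and> (\<lambda>v. P *\<^sub>v v) ` carrier_vec D = W"

definition orth_proj :: "nat \<Rightarrow> complex vec set \<Rightarrow> complex mat" where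
  "orth_proj D W = (THE P. is_orth_proj D W P)"

definition orthonormal_set :: "nat \<Rightarrow> complex vec set \<Rightarrow> bool" where
  "orthonormal_set D B \<longleftrightarrow> B \<subseteq> carrier_vec D \<and>
     (\<forall>u \<in> B. \<forall>v \<in> B. u \<bullet>c v = (if u = v then 1 else 0))"

definition povm :: "nat \<Rightarrow> nat \<Rightarrow> (nat \<Rightarrow> complex mat) \<Rightarrow> bool" where
  "povm D N E \<longleftrightarrow> (\<forall>x<N. positive_op D (E x)) \<and>
     mat D D (\<lambda>(i, j). \<Sum>x<N. E x $$ (i, j)) = 1\<^sub>m D"


section \<open>LOCC\<close>

text \<open>
  A multipartite system is given by the list \<open>ds\<close> of its local dimensions; its Hilbert space is
  \<open>\<complex>\<^sup>D\<close> with \<open>D = prod_list ds\<close>, the tensor factors being ordered as in \<^const>\<open>kron\<close>.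

  A protocol is a finite tree. In \<open>Measure k bs\<close>, party \<open>k\<close> (counted from 0) performs a measurement;
  each branch in \<open>bs\<close> consists of the Kraus operator of one outcome and the rest of the protocol,
  to be followed by all parties after that outcome has been broadcast. Kraus operators may be
  rectangular, so that the local dimension may change: this covers the introduction and the
  removal of local ancillas. A local random choice is a measurement with Kraus operators that are
  multiples of the identity. \<open>Outcome x\<close> ends the protocol with the result \<open>x\<close>; as the label of
  a leaf is arbitrary, classical post-processing is included.
\<close>

datatype locc = Outcome nat | Measure nat "(complex mat \<times> locc) list"

definition local_op :: "nat list \<Rightarrow> nat \<Rightarrow> complex mat \<Rightarrow> complex mat" where
  "local_op ds k K =
     kron (1\<^sub>m (prod_list (take k ds))) (kron K (1\<^sub>m (prod_list (drop (Suc k) ds))))"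

text \<open>\<open>\<Sum>\<^sub>a K\<^sub>a\<^sup>\<dagger> K\<^sub>a = \<one>\<close> on \<open>\<complex>\<^sup>d\<close>\<close>

definition kraus_complete :: "nat \<Rightarrow> complex mat list \<Rightarrow> bool" where
  "kraus_complete d Ks \<longleftrightarrow> (\<forall>K \<in> set Ks. dim_col K = d) \<and>
     mat d d (\<lambda>(i, j). \<Sum>K\<leftarrow>Ks. (mat_adjoint K * K) $$ (i, j)) = 1\<^sub>m d"

fun valid_locc :: "nat list \<Rightarrow> locc \<Rightarrow> bool" where
  "valid_locc ds (Outcome x) \<longleftrightarrow> True"
| "valid_locc ds (Measure k bs) \<longleftrightarrow>
     k < length ds \<and> kraus_complete (ds ! k) (map fst bs) \<and>
     (\<forall>(K, P) \<in> set bs. valid_locc (ds[k := dim_row K]) P)"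

text \<open>
  The probability that a protocol started in the state \<open>\<rho>\<close> yields the result \<open>x\<close>. The states passed
  down the tree are unnormalised: their trace is the probability of the branch.
\<close>

fun locc_prob :: "nat list \<Rightarrow> locc \<Rightarrow> complex mat \<Rightarrow> nat \<Rightarrow> complex" where
  "locc_prob ds (Outcome y) \<rho> x = (if y = x then trace \<rho> else 0)"
| "locc_prob ds (Measure k bs) \<rho> x =
     (\<Sum>(K, P)\<leftarrow>bs. locc_prob (ds[k := dim_row K]) P
        (local_op ds k K * \<rho> * mat_adjoint (local_op ds k K)) x)"

definition locc_implementable :: "nat list \<Rightarrow> nat \<Rightarrow> (nat \<Rightarrow> complex mat) \<Rightarrow> bool" where
  "locc_implementable ds N E \<longleftrightarrow> povm (prod_list ds) N E \<and>
     (\<exists>P. valid_locc ds P \<and>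
        (\<forall>\<rho>. density_op (prod_list ds) \<rho> \<longrightarrow> (\<forall>x<N. locc_prob ds P \<rho> x = trace (E x * \<rho>))))"


section \<open>Authentication\<close>

definition perfectly_answered :: "nat list \<Rightarrow> complex vec set \<Rightarrow> complex vec \<Rightarrow> bool" where
  "perfectly_answered ds S \<psi> \<longleftrightarrow>
     (\<exists>E. locc_implementable ds 2 E \<and> expect (E 1) \<psi> = 1 \<and> (\<forall>\<phi> \<in> S - {\<psi>}. expect (E 1) \<phi> = 0))"


section \<open>The change point problem\<close>

definition change_point_problem ::
    "nat list \<Rightarrow> nat \<Rightarrow> complex vec \<Rightarrow> complex vec set \<Rightarrow> nat \<Rightarrow> bool" where
  "change_point_problem ds d \<psi> Smutd M \<longleftrightarrow>
     1 \<le> M \<and> 2 \<le> d \<and> finite Smutd \<and>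
     card Smutd = d - 1 \<and> \<psi> \<notin> Smutd \<and>
     orthonormal_set (prod_list ds) (insert \<psi> Smutd)"

text \<open>
  The state of the \<open>M\<close> copies for change point \<open>k\<close>, on the tensor product of \<open>M\<close> copies
  of \<open>\<complex>\<^sup>D\<close>.
\<close>

definition change_point_state ::
    "nat \<Rightarrow> nat \<Rightarrow> complex vec \<Rightarrow> complex vec set \<Rightarrow> nat \<Rightarrow> nat \<Rightarrow> complex mat" where
  "change_point_state D d \<psi> Smutd M k = kron_list
     (replicate k (ket_bra \<psi>) @
      replicate (M - k) ((1 / (of_nat d - 1)) \<cdot>\<^sub>m orth_proj D (vec_span D Smutd)))"

text \<open>
  An adaptive strategy \<open>A\<close> assigns to each list of earlier outcomes the POVM that is used
  to measure the next copy. The effect of the complete outcome record \<open>xs\<close> on the \<open>M\<close> copies is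
  the tensor product of the effects obtained on the individual copies.
\<close>

definition record_effect :: "(nat list \<Rightarrow> nat \<Rightarrow> complex mat) \<Rightarrow> nat list \<Rightarrow> complex mat" where
  "record_effect A xs = kron_list (map (\<lambda>j. A (take j xs) (xs ! j)) [0..<length xs])"

definition records :: "nat \<Rightarrow> nat \<Rightarrow> nat list set" where
  "records N m = {xs. length xs = m \<and> set xs \<subseteq> {..<N}}"

text \<open>
  All steps of a strategy share the outcome set \<open>{..<N}\<close>. This is no restriction, since there are
  finitely many histories and a POVM may be padded with zero effects. The function \<open>guess\<close>
  turns the complete outcome record into the announced change point, which must be correct with
  probability 1.
\<close>

definition adaptively_locally_solvable ::
    "nat list \<Rightarrow> nat \<Rightarrow> complex vec \<Rightarrow> complex vec set \<Rightarrow> nat \<Rightarrow> bool" where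
  "adaptively_locally_solvable ds d \<psi> Smutd M \<longleftrightarrow>
     (\<exists>N A guess.
        (\<forall>m<M. \<forall>h \<in> records N m. locc_implementable ds N (A h)) \<and>
        (\<forall>k \<le> M. (\<Sum>xs \<in> {xs \<in> records N M. guess xs = k}.
            trace (record_effect A xs * change_point_state (prod_list ds) d \<psi> Smutd M k)) = 1))"

end

theory Submission
  imports Defs
begin

text \<open>
  If the question is answered by \<open>{E 0, E 1}\<close>, measuring it on every copy yields, for change point
  \<open>k\<close>, with certainty the record of \<open>k\<close> ones followed by zeros.

  Conversely, the states for \<open>k = M\<close> and \<open>k = M - 1\<close> differ only in the last copy. Choose a history
  \<open>h\<close> of the first \<open>M - 1\<close> steps that has positive probability when all copies are in the state
  \<open>\<psi>\<close>. It has the same probability for both change points, so the last measurement \<open>A h\<close>,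
  coarse-grained according to whether the announced change point is \<open>M\<close>, must distinguish \<open>\<psi>\<close>
  perfectly from the uniform mixture of \<open>Smutd\<close>, and hence from each of its members.
\<close>

section \<open>Traces\<close>

lemma trace_mult:
  assumes "A \<in> carrier_mat D D" and "B \<in> carrier_mat D D"
  shows "trace (A * B) = (\<Sum>i<D. \<Sum>j<D. A $$ (i, j) * B $$ (j, i))"
  using assms by (auto simp: trace_def scalar_prod_def atLeast0LessThan intro!: sum.cong)

section \<open>Kronecker products and their traces\<close>

lemma kron_carrier:
  assumes "A \<in> carrier_mat a b" and "B \<in> carrier_mat c e"
  shows "kron A B \<in> carrier_mat (a * c) (b * e)"
  using assms by (simp add: kron_def)

text \<open>\<open>kron\<close> encodes a pair of indices by quotient and remainder, so this splits
  a sum over a tensor product index into sums over its factors. Induction on \<open>a\<close> peels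
  off the last block of length \<open>b\<close>, on which the quotient is constant.\<close>

lemma sum_div_mod:
  fixes f :: "nat \<Rightarrow> nat \<Rightarrow> 'a :: comm_monoid_add"
  shows "(\<Sum>i<a * b. f (i div b) (i mod b)) = (\<Sum>i<a. \<Sum>j<b. f i j)"
proof (induction a)
  case (Suc a)
  have q: "i div b = a" if "a * b \<le> i" "i < a * b + b" for i
    using that by (intro div_nat_eqI) (auto simp: mult.commute)
  have "(\<Sum>i<Suc a * b. f (i div b) (i mod b)) =
      (\<Sum>i<a * b. f (i div b) (i mod b)) + (\<Sum>i\<in>{a * b..<a * b + b}. f (i div b) (i mod b))"
    by (subst sum.union_disjoint[symmetric]) (auto intro!: sum.cong)
  also have "(\<Sum>i\<in>{a * b..<a * b + b}. f (i div b) (i mod b)) = (\<Sum>j<b. f a j)"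
    by (rule sum.reindex_bij_witness[of _ "\<lambda>j. a * b + j" "\<lambda>i. i - a * b"])
      (auto simp: q modulo_nat_def mult.commute)
  finally show ?case using Suc by simp
qed simp

text \<open>Once both indices are split into pairs, the summand is a product of a term in the first
  components and a term in the second; swapping the two middle sums then separates the
  traces.\<close>

lemma trace_kron_mult:
  assumes "A \<in> carrier_mat a a" and "A' \<in> carrier_mat a a"
    and "B \<in> carrier_mat b b" and "B' \<in> carrier_mat b b"
  shows "trace (kron A B * kron A' B') = trace (A * A') * trace (B * B')"
proof -
  define f where "f i i' j j' = A $$ (i, j) * A' $$ (j, i) * (B $$ (i', j') * B' $$ (j', i'))"
    for i i' j j'
  have "trace (kron A B * kron A' B') =
      (\<Sum>i<a * b. \<Sum>j<a * b. kron A B $$ (i, j) * kron A' B' $$ (j, i))"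
    using assms by (intro trace_mult kron_carrier)
  also have "\<dots> = (\<Sum>i<a * b. \<Sum>j<a * b. f (i div b) (i mod b) (j div b) (j mod b))"
    using assms by (intro sum.cong refl) (simp add: f_def kron_def)
  also have "\<dots> = (\<Sum>i<a * b. \<Sum>j<a. \<Sum>j'<b. f (i div b) (i mod b) j j')"
    by (simp add: sum_div_mod[where f = "f _ _"])
  also have "\<dots> = (\<Sum>i<a. \<Sum>i'<b. \<Sum>j<a. \<Sum>j'<b. f i i' j j')"
    by (rule sum_div_mod)
  also have "\<dots> = (\<Sum>i<a. \<Sum>j<a. \<Sum>i'<b. \<Sum>j'<b. f i i' j j')"
    by (intro sum.cong refl sum.swap)
  also have "\<dots> = trace (A * A') * trace (B * B')"
    unfolding f_def trace_mult[OF assms(1,2)] trace_mult[OF assms(3,4)]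
    by (simp only: sum_distrib_right, simp only: sum_distrib_left)
  finally show ?thesis .
qed

lemma kron_list_carrier:
  assumes "\<forall>A \<in> set As. A \<in> carrier_mat D D"
  shows "kron_list As \<in> carrier_mat (D ^ length As) (D ^ length As)"
  using assms by (induction As) (auto simp: kron_list_def kron_carrier)

text \<open>This is what turns the probability of an outcome record on all copies into a product of
  single-copy probabilities.\<close>

lemma trace_kron_list_mult:
  assumes "length As = length Bs"
    and "\<forall>A \<in> set As. A \<in> carrier_mat D D" and "\<forall>B \<in> set Bs. B \<in> carrier_mat D D"
  shows "trace (kron_list As * kron_list Bs) = (\<Prod>j<length As. trace (As ! j * Bs ! j))"
  using assms
proof (induction As Bs rule: list_induct2)
  case Nil
  then show ?case by (simp add: kron_list_def trace_def)
next
  case (Cons A As B Bs)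
  have "trace (kron_list (A # As) * kron_list (B # Bs)) =
      trace (A * B) * trace (kron_list As * kron_list Bs)"
    using Cons.prems Cons.hyps kron_list_carrier[of As D] kron_list_carrier[of Bs D]
      trace_kron_mult[of A D B "kron_list As" "D ^ length As" "kron_list Bs"]
    by (simp add: kron_list_def)
  then show ?case
    using Cons by (simp add: prod.lessThan_Suc_shift del: prod.lessThan_Suc)
qed

section \<open>Expectation values and the projector on the span\<close>

lemma expect_eq_sum:
  assumes "E \<in> carrier_mat D D" and "\<phi> \<in> carrier_vec D"
  shows "expect E \<phi> = (\<Sum>i<D. \<Sum>j<D. E $$ (i, j) * (\<phi> $ j * cnj (\<phi> $ i)))"
  using assms
  by (auto simp: expect_def scalar_prod_def atLeast0LessThan sum_distrib_right mult.assoc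
      intro!: sum.cong)

lemma ket_bra_carrier: "\<phi> \<in> carrier_vec D \<Longrightarrow> ket_bra \<phi> \<in> carrier_mat D D"
  by (auto simp: ket_bra_def)

lemma trace_mult_ket_bra:
  assumes "E \<in> carrier_mat D D" and "\<phi> \<in> carrier_vec D"
  shows "trace (E * ket_bra \<phi>) = expect E \<phi>"
  unfolding expect_eq_sum[OF assms] trace_mult[OF assms(1) ket_bra_carrier[OF assms(2)]]
  using assms by (auto simp: ket_bra_def intro!: sum.cong)

section \<open>Uniqueness of orthogonal projectors\<close>

lemma mult_mat_vec_unit_vec:
  fixes A :: "'a :: semiring_1 mat"
  assumes "A \<in> carrier_mat m n" and "j < n"
  shows "A *\<^sub>v unit_vec n j = col A j"
  using assms col_mult2[of A m n "1\<^sub>m n" n j] by simp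

text \<open>\<open>P\<close> acts as the identity on its range \<open>W\<close> by idempotence, and
  every column of \<open>Q\<close> lies in \<open>W\<close>.\<close>

lemma is_orth_proj_mult:
  assumes "is_orth_proj D W P" and "is_orth_proj D W Q"
  shows "P * Q = Q"
proof (rule eq_matI)
  have P: "P \<in> carrier_mat D D" "P * P = P" and Q: "Q \<in> carrier_mat D D"
    using assms by (auto simp: is_orth_proj_def)
  have fix_range: "P *\<^sub>v w = w" if "w \<in> W" for w
  proof -
    obtain v where v: "v \<in> carrier_vec D" "w = P *\<^sub>v v"
      using assms(1) \<open>w \<in> W\<close> by (auto simp: is_orth_proj_def)
    then show ?thesis
      using P by (metis assoc_mult_mat_vec)
  qed
  fix i j assume "i < dim_row Q" "j < dim_col Q"
  then have ij: "i < D" "j < D" using Q by auto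
  have "col Q j = Q *\<^sub>v unit_vec D j"
    using Q ij by (simp add: mult_mat_vec_unit_vec)
  then have "col Q j \<in> W"
    using assms(2) by (auto simp: is_orth_proj_def)
  then have "col (P * Q) j = col Q j"
    using fix_range by (simp only: col_mult2[OF P(1) Q ij(2)])
  then show "(P * Q) $$ (i, j) = Q $$ (i, j)"
    using P Q ij by (metis carrier_matD index_col index_mult_mat(2,3))
qed (use assms in \<open>auto simp: is_orth_proj_def\<close>)

lemma mat_adjoint_index:
  "i < dim_col A \<Longrightarrow> j < dim_row A \<Longrightarrow> mat_adjoint A $$ (i, j) = conjugate (A $$ (j, i))"
  by (simp add: mat_adjoint_def mat_of_rows_index)

lemma mat_adjoint_dim [simp]:
  "dim_row (mat_adjoint A) = dim_col A"
  "dim_col (mat_adjoint A) = dim_row A"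
  by (simp_all add: mat_adjoint_def)

lemma mat_adjoint_mult:
  fixes A B :: "complex mat"
  assumes "A \<in> carrier_mat D D" "B \<in> carrier_mat D D"
  shows "mat_adjoint (A * B) = mat_adjoint B * mat_adjoint A"
  using assms
  by (intro eq_matI) (auto simp: mat_adjoint_index scalar_prod_def mult.commute intro!: sum.cong)

text \<open>Taking adjoints in \<open>P = Q * P\<close> gives \<open>P = P * Q\<close>, which equals
  \<open>Q\<close> by the same absorption rule with the roles exchanged.\<close>

lemma is_orth_proj_unique:
  assumes "is_orth_proj D W P" and "is_orth_proj D W Q"
  shows "P = Q"
proof -
  have "P = mat_adjoint (Q * P)"
    using assms is_orth_proj_mult[OF assms(2,1)] by (simp add: is_orth_proj_def)
  also have "\<dots> = P * Q"
    using assms mat_adjoint_mult[of Q D P] by (simp add: is_orth_proj_def)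
  also have "\<dots> = Q"
    by (rule is_orth_proj_mult[OF assms])
  finally show ?thesis .
qed

section \<open>The projector onto the span of an orthonormal set\<close>

definition sum_ket_bra :: "nat \<Rightarrow> complex vec set \<Rightarrow> complex mat" where
  "sum_ket_bra D S = mat D D (\<lambda>(i, j). \<Sum>\<phi>\<in>S. \<phi> $ i * cnj (\<phi> $ j))"

lemma sum_ket_bra_mult_vec:
  assumes "S \<subseteq> carrier_vec D" and "v \<in> carrier_vec D" and "i < D"
  shows "(sum_ket_bra D S *\<^sub>v v) $ i = (\<Sum>\<phi>\<in>S. (v \<bullet>c \<phi>) * \<phi> $ i)"
proof -
  have "(sum_ket_bra D S *\<^sub>v v) $ i = (\<Sum>j<D. \<Sum>\<phi>\<in>S. \<phi> $ i * cnj (\<phi> $ j) * v $ j)"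
    using assms by (simp add: sum_ket_bra_def scalar_prod_def atLeast0LessThan sum_distrib_right)
  also have "\<dots> = (\<Sum>\<phi>\<in>S. \<Sum>j<D. \<phi> $ i * cnj (\<phi> $ j) * v $ j)"
    by (rule sum.swap)
  also have "\<dots> = (\<Sum>\<phi>\<in>S. (v \<bullet>c \<phi>) * \<phi> $ i)"
    using assms
    by (intro sum.cong refl)
      (auto simp: scalar_prod_def atLeast0LessThan sum_distrib_left sum_distrib_right mult_ac subset_iff
        intro!: sum.cong)
  finally show ?thesis .
qed

text \<open>The matrix sends \<open>v\<close> to the linear combination of \<open>S\<close> with
  coefficients \<open>v \<bullet>c \<phi>\<close>. Orthonormality makes these the true coefficients
  when \<open>v\<close> is itself a combination of \<open>S\<close>, so the span is fixed pointwise;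
  idempotence and the range follow.\<close>

lemma is_orth_proj_sum_ket_bra:
  assumes "finite S" and "orthonormal_set D S"
  shows "is_orth_proj D (vec_span D S) (sum_ket_bra D S)"
proof -
  interpret vec_space "TYPE(complex)" D .
  have S: "S \<subseteq> carrier_vec D" and orth: "\<And>u v. u \<in> S \<Longrightarrow> v \<in> S \<Longrightarrow> u \<bullet>c v = (if u = v then 1 else 0)"
    using assms(2) by (auto simp: orthonormal_set_def)
  let ?P = "sum_ket_bra D S"
  have P: "?P \<in> carrier_mat D D" by (simp add: sum_ket_bra_def)
  have P_lincomb: "?P *\<^sub>v v = lincomb (\<lambda>\<phi>. v \<bullet>c \<phi>) S" if "v \<in> carrier_vec D" for v
    using that P lincomb_dim[OF assms(1) S]
    by (intro eq_vecI) (auto simp: sum_ket_bra_mult_vec[OF S] lincomb_index[OF _ S]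
        simp del: index_mult_mat_vec)
  have coeff: "lincomb a S \<bullet>c \<phi> = a \<phi>" if "\<phi> \<in> S" for a \<phi>
  proof -
    have "lincomb a S \<bullet>c \<phi> = (\<Sum>i<D. \<Sum>u\<in>S. a u * u $ i * cnj (\<phi> $ i))"
      using S that by (auto simp: scalar_prod_def atLeast0LessThan lincomb_index sum_distrib_right subset_iff
          intro!: sum.cong)
    also have "\<dots> = (\<Sum>u\<in>S. \<Sum>i<D. a u * u $ i * cnj (\<phi> $ i))"
      by (rule sum.swap)
    also have "\<dots> = (\<Sum>u\<in>S. a u * (u \<bullet>c \<phi>))"
      using S that by (auto simp: scalar_prod_def atLeast0LessThan sum_distrib_left mult.assoc subset_iff
          intro!: sum.cong)
    also have "\<dots> = (\<Sum>u\<in>S. if u = \<phi> then a \<phi> else 0)"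
      by (intro sum.cong) (auto simp: orth that)
    finally show ?thesis using that assms(1) by simp
  qed
  have lincomb_carrier: "lincomb a S \<in> carrier_vec D" for a
    using lincomb_dim[OF assms(1) S] by (rule carrier_vecI)
  have fixed: "?P *\<^sub>v lincomb a S = lincomb a S" for a
    unfolding P_lincomb[OF lincomb_carrier]
    by (intro eq_vecI) (auto simp: lincomb_index S coeff lincomb_dim[OF assms(1) S])
  have PP: "?P *\<^sub>v (?P *\<^sub>v v) = ?P *\<^sub>v v" if "v \<in> carrier_vec D" for v
    using fixed that by (simp add: P_lincomb)
  have "?P * ?P = ?P"
  \<comment> \<open>Idempotence is known only on vectors; applying it to unit vectors gives equality
    of columns.\<close>
  proof (rule eq_matI)
    fix i j assume "i < dim_row ?P" "j < dim_col ?P"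
    then have ij: "i < D" "j < D" using P by auto
    have "col (?P * ?P) j = col ?P j"
      using PP[of "unit_vec D j"]
      by (simp only: col_mult2[OF P P ij(2)] mult_mat_vec_unit_vec[OF P ij(2)] unit_vec_carrier)
    then show "(?P * ?P) $$ (i, j) = ?P $$ (i, j)"
      using P ij by (metis carrier_matD index_col index_mult_mat(2,3))
  qed (use P in auto)
  moreover have "mat_adjoint ?P = ?P"
    using P by (intro eq_matI) (auto simp: mat_adjoint_index sum_ket_bra_def mult.commute intro!: sum.cong)
  moreover have "(\<lambda>v. ?P *\<^sub>v v) ` carrier_vec D = span S"
  proof
    show "(\<lambda>v. ?P *\<^sub>v v) ` carrier_vec D \<subseteq> span S"
      using assms(1) by (auto simp: P_lincomb)
    show "span S \<subseteq> (\<lambda>v. ?P *\<^sub>v v) ` carrier_vec D"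
    proof
      fix w assume "w \<in> span S"
      then obtain a where "w = lincomb a S"
        using assms(1) S by (auto simp: finite_span)
      then show "w \<in> (\<lambda>v. ?P *\<^sub>v v) ` carrier_vec D"
        using fixed lincomb_carrier by (metis image_eqI)
    qed
  qed
  ultimately show ?thesis
    using P by (simp add: is_orth_proj_def vec_span_def)
qed

text \<open>Existence and uniqueness together resolve the definite description in
  \<open>orth_proj\<close>.\<close>

lemma orth_proj_eq_sum_ket_bra:
  assumes "finite S" and "orthonormal_set D S"
  shows "orth_proj D (vec_span D S) = sum_ket_bra D S"
  unfolding orth_proj_def
  using is_orth_proj_sum_ket_bra[OF assms] is_orth_proj_unique by blast

lemma trace_mult_sum_ket_bra:
  assumes "E \<in> carrier_mat D D" and "S \<subseteq> carrier_vec D"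
  shows "trace (E * (c \<cdot>\<^sub>m sum_ket_bra D S)) = c * (\<Sum>\<phi>\<in>S. expect E \<phi>)"
proof -
  have "trace (E * (c \<cdot>\<^sub>m sum_ket_bra D S)) =
      (\<Sum>i<D. \<Sum>j<D. \<Sum>\<phi>\<in>S. c * (E $$ (i, j) * (\<phi> $ j * cnj (\<phi> $ i))))"
    using assms
    by (subst trace_mult[of _ D]) (auto simp: sum_ket_bra_def sum_distrib_left mult_ac intro!: sum.cong)
  also have "\<dots> = (\<Sum>\<phi>\<in>S. \<Sum>i<D. \<Sum>j<D. c * (E $$ (i, j) * (\<phi> $ j * cnj (\<phi> $ i))))"
    by (subst sum.swap[of _ S], subst sum.swap[of _ S]) (rule refl)
  also have "\<dots> = c * (\<Sum>\<phi>\<in>S. expect E \<phi>)"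
    using assms by (auto simp: sum_distrib_left expect_eq_sum subset_iff intro!: sum.cong)
  finally show ?thesis .
qed

section \<open>Coarse-graining\<close>

text \<open>Classical post-processing of outcome \<open>y\<close> into \<open>f y\<close>, at the
  level of effects.\<close>

definition coarsen :: "nat \<Rightarrow> nat \<Rightarrow> (nat \<Rightarrow> nat) \<Rightarrow> (nat \<Rightarrow> complex mat) \<Rightarrow> nat \<Rightarrow> complex mat" where
  "coarsen D N f E x = mat D D (\<lambda>(i, j). \<Sum>y | y < N \<and> f y = x. E y $$ (i, j))"

lemma coarsen_carrier: "coarsen D N f E x \<in> carrier_mat D D"
  by (simp add: coarsen_def)

lemma trace_coarsen_mult:
  assumes "\<And>y. y < N \<Longrightarrow> E y \<in> carrier_mat D D" and "\<rho> \<in> carrier_mat D D"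
  shows "trace (coarsen D N f E x * \<rho>) = (\<Sum>y | y < N \<and> f y = x. trace (E y * \<rho>))"
proof -
  let ?Y = "{y. y < N \<and> f y = x}"
  have "trace (coarsen D N f E x * \<rho>) = (\<Sum>i<D. \<Sum>j<D. \<Sum>y\<in>?Y. E y $$ (i, j) * \<rho> $$ (j, i))"
    using assms(2) by (subst trace_mult[of _ D]) (auto simp: coarsen_def sum_distrib_right)
  also have "\<dots> = (\<Sum>y\<in>?Y. \<Sum>i<D. \<Sum>j<D. E y $$ (i, j) * \<rho> $$ (j, i))"
    by (subst sum.swap[of _ ?Y], subst sum.swap[of _ ?Y]) (rule refl)
  also have "\<dots> = (\<Sum>y\<in>?Y. trace (E y * \<rho>))"
    using assms by (intro sum.cong refl) (simp add: trace_mult[of _ D])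
  finally show ?thesis .
qed

lemma expect_coarsen:
  assumes "\<And>y. y < N \<Longrightarrow> E y \<in> carrier_mat D D" and "\<phi> \<in> carrier_vec D"
  shows "expect (coarsen D N f E x) \<phi> = (\<Sum>y | y < N \<and> f y = x. expect (E y) \<phi>)"
proof -
  have "expect (coarsen D N f E x) \<phi> = trace (coarsen D N f E x * ket_bra \<phi>)"
    using assms by (simp add: trace_mult_ket_bra[OF coarsen_carrier])
  also have "\<dots> = (\<Sum>y | y < N \<and> f y = x. expect (E y) \<phi>)"
    using assms
    by (subst trace_coarsen_mult) (auto simp: ket_bra_carrier trace_mult_ket_bra[of _ D] intro!: sum.cong)
  finally show ?thesis .
qed

section \<open>Effects of a POVM\<close>

lemma povm_carrier: "povm D N E \<Longrightarrow> x < N \<Longrightarrow> E x \<in> carrier_mat D D"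
  by (simp add: povm_def positive_op_def)

lemma povm_expect_nonneg: "povm D N E \<Longrightarrow> x < N \<Longrightarrow> \<phi> \<in> carrier_vec D \<Longrightarrow> 0 \<le> expect (E x) \<phi>"
  by (simp add: povm_def positive_op_def expect_def)

lemma povm_sum:
  assumes "povm D N E" and "i < D" and "j < D"
  shows "(\<Sum>x<N. E x $$ (i, j)) = (if i = j then 1 else 0)"
proof -
  have "mat D D (\<lambda>(i, j). \<Sum>x<N. E x $$ (i, j)) $$ (i, j) = 1\<^sub>m D $$ (i, j)"
    using assms(1) by (simp add: povm_def)
  then show ?thesis using assms by simp
qed

lemma sum_expect_povm:
  assumes "povm D N E" and "\<phi> \<in> carrier_vec D"
  shows "(\<Sum>x<N. expect (E x) \<phi>) = \<phi> \<bullet>c \<phi>"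
proof -
  have "(\<Sum>x<N. expect (E x) \<phi>) =
      (\<Sum>x<N. \<Sum>i<D. \<Sum>j<D. E x $$ (i, j) * (\<phi> $ j * cnj (\<phi> $ i)))"
    using assms by (intro sum.cong refl expect_eq_sum) (auto intro: povm_carrier)
  also have "\<dots> = (\<Sum>i<D. \<Sum>j<D. \<Sum>x<N. E x $$ (i, j) * (\<phi> $ j * cnj (\<phi> $ i)))"
    by (subst sum.swap[of _ _ "{..<N}"], subst sum.swap[of _ _ "{..<N}"]) (rule refl)
  also have "\<dots> = (\<Sum>i<D. \<Sum>j<D. if i = j then \<phi> $ j * cnj (\<phi> $ i) else 0)"
    by (intro sum.cong refl) (auto simp: povm_sum[OF assms(1)] simp flip: sum_distrib_right)
  also have "\<dots> = \<phi> \<bullet>c \<phi>"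
    using assms(2) by (simp add: scalar_prod_def atLeast0LessThan)
  finally show ?thesis .
qed

text \<open>Since \<open>f\<close> maps \<open>{..<N}\<close> into \<open>{..<N'}\<close>, its
  fibres over the new labels partition the old outcomes, so no effect is lost and completeness
  survives; positivity passes to sums.\<close>

lemma povm_coarsen:
  assumes "povm D N E" and "\<And>y. y < N \<Longrightarrow> f y < N'"
  shows "povm D N' (coarsen D N f E)"
  unfolding povm_def
proof (intro conjI allI impI)
  fix x assume "x < N'"
  have "0 \<le> expect (coarsen D N f E x) v" if "v \<in> carrier_vec D" for v
    using that povm_expect_nonneg[OF assms(1)]
    by (auto simp: expect_coarsen povm_carrier[OF assms(1)] intro!: sum_nonneg)
  then show "positive_op D (coarsen D N f E x)"
    by (simp add: positive_op_def coarsen_carrier expect_def)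
next
  have "(\<Sum>x<N'. coarsen D N f E x $$ (i, j)) = (\<Sum>y<N. E y $$ (i, j))" if "i < D" "j < D" for i j
    using that assms(2) sum.group[of "{..<N}" "{..<N'}" f "\<lambda>y. E y $$ (i, j)"]
    by (auto simp: coarsen_def)
  then show "mat D D (\<lambda>(i, j). \<Sum>x<N'. coarsen D N f E x $$ (i, j)) = 1\<^sub>m D"
    by (intro eq_matI) (auto simp: povm_sum[OF assms(1)])
qed

section \<open>Relabelling the leaves of a protocol\<close>

primrec relabel :: "(nat \<Rightarrow> nat) \<Rightarrow> locc \<Rightarrow> locc" where
  "relabel f (Outcome y) = Outcome (f y)"
| "relabel f (Measure k bs) = Measure k (map (map_prod id (relabel f)) bs)"

lemma valid_locc_relabel: "valid_locc ds P \<Longrightarrow> valid_locc ds (relabel f P)"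
  by (induction ds P rule: valid_locc.induct) (fastforce simp: o_def)+

lemma sum_list_sum_swap: "(\<Sum>b\<leftarrow>bs. \<Sum>y\<in>Y. g b y) = (\<Sum>y\<in>Y. \<Sum>b\<leftarrow>bs. g b y)"
  for g :: "'b \<Rightarrow> 'c \<Rightarrow> 'a :: comm_monoid_add"
  by (induction bs) (simp_all add: sum.distrib)

text \<open>The tree and its Kraus operators are unchanged, so only the leaves matter and the branch
  sums commute with the sum over the fibre. Finiteness of the fibre is assumed because a sum over an
  infinite set is 0 by convention.\<close>

lemma locc_prob_relabel:
  assumes "finite {y. f y = x}"
  shows "locc_prob ds (relabel f P) \<rho> x = (\<Sum>y | f y = x. locc_prob ds P \<rho> y)"
  using assms
proof (induction ds P \<rho> x rule: locc_prob.induct)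
  case (1 ds y \<rho> x)
  then show ?case by simp
next
  case (2 ds k bs \<rho> x)
  have "locc_prob ds (relabel f (Measure k bs)) \<rho> x =
      (\<Sum>(K, P)\<leftarrow>bs. \<Sum>y | f y = x. locc_prob (ds[k := dim_row K]) P
        (local_op ds k K * \<rho> * mat_adjoint (local_op ds k K)) y)"
    using 2 by (auto simp: o_def intro!: arg_cong[where f = sum_list])
  then show ?case by (simp add: case_prod_unfold sum_list_sum_swap)
qed

text \<open>The protocol that implements \<open>E\<close> also implements the coarse-grained POVM
  once its leaves are relabelled.\<close>

lemma locc_implementable_coarsen:
  assumes "locc_implementable ds N E" and f: "\<And>y. y < N \<Longrightarrow> f y < N'"
  shows "locc_implementable ds N' (coarsen (prod_list ds) N f E)"
proof -
  let ?D = "prod_list ds"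
  obtain P where povm: "povm ?D N E" and P: "valid_locc ds P"
    and prob: "\<And>\<rho> x. density_op ?D \<rho> \<Longrightarrow> x < N \<Longrightarrow> locc_prob ds P \<rho> x = trace (E x * \<rho>)"
    using assms(1) by (auto simp: locc_implementable_def)
  \<comment> \<open>Leaves of \<open>P\<close> may carry labels outside \<open>{..<N}\<close>; they are sent to the unused label \<open>N'\<close>.\<close>
  define g where "g y = (if y < N then f y else N')" for y
  \<comment> \<open>Fibres over labels below \<open>N'\<close> miss the dummy label, so they are
    finite and contain only outcomes of \<open>E\<close>.\<close>
  have fibre: "{y. g y = x} = {y. y < N \<and> f y = x}" if "x < N'" for x
    using that by (auto simp: g_def)
  have "locc_prob ds (relabel g P) \<rho> x = trace (coarsen ?D N f E x * \<rho>)"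
    if "density_op ?D \<rho>" "x < N'" for \<rho> x
  proof -
    have "\<rho> \<in> carrier_mat ?D ?D" using that by (simp add: density_op_def positive_op_def)
    then show ?thesis
      using that by (simp add: locc_prob_relabel trace_coarsen_mult povm_carrier[OF povm] fibre prob)
  qed
  then show ?thesis
    using povm_coarsen[of ?D N E f N', OF povm f] valid_locc_relabel[OF P, of g]
    by (auto simp: locc_implementable_def)
qed

section \<open>Sequential strategies\<close>

lemma records_0: "records N 0 = {[]}"
  by (auto simp: records_def)

lemma records_take: "xs \<in> records N m \<Longrightarrow> j \<le> m \<Longrightarrow> take j xs \<in> records N j"
  using set_take_subset by (fastforce simp: records_def)

lemma records_nth: "xs \<in> records N m \<Longrightarrow> j < m \<Longrightarrow> xs ! j < N"
  using nth_mem by (fastforce simp: records_def)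

lemma records_snoc: "h @ [x] \<in> records N (Suc m) \<longleftrightarrow> h \<in> records N m \<and> x < N"
  by (auto simp: records_def)

lemma finite_records: "finite (records N m)"
  unfolding records_def using finite_lists_length_eq[of "{..<N}" m] by (simp add: conj_commute)

text \<open>The last outcome is the one split off, because the POVM of a step depends on the prefix
  before it.\<close>

lemma sum_records_Suc:
  "(\<Sum>xs\<in>records N (Suc m). g xs) = (\<Sum>h\<in>records N m. \<Sum>x<N. g (h @ [x]))"
proof -
  have "(\<Sum>h\<in>records N m. \<Sum>x<N. g (h @ [x])) = (\<Sum>(h, x)\<in>records N m \<times> {..<N}. g (h @ [x]))"
    by (rule sum.cartesian_product)
  also have "\<dots> = (\<Sum>xs\<in>records N (Suc m). g xs)"
  proof (rule sum.reindex_bij_witness[of _ "\<lambda>xs. (butlast xs, last xs)" "\<lambda>(h, x). h @ [x]"])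
    fix xs assume "xs \<in> records N (Suc m)"
    moreover from this have "xs \<noteq> []" by (auto simp: records_def)
    ultimately show "(\<lambda>(h, x). h @ [x]) (butlast xs, last xs) = xs"
      and "(butlast xs, last xs) \<in> records N m \<times> {..<N}"
      using records_snoc[of "butlast xs" "last xs"] by auto
  qed (auto simp: records_snoc)
  finally show ?thesis ..
qed

section \<open>Probabilities of outcome records on product states\<close>

definition record_prob ::
    "(nat list \<Rightarrow> nat \<Rightarrow> complex mat) \<Rightarrow> (nat \<Rightarrow> complex mat) \<Rightarrow> nat list \<Rightarrow> complex" where
  "record_prob A s xs = (\<Prod>j<length xs. trace (A (take j xs) (xs ! j) * s j))"

lemma record_prob_snoc:
  "record_prob A s (h @ [x]) = record_prob A s h * trace (A h x * s (length h))"
  by (simp add: record_prob_def nth_append)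

text \<open>The order on \<open>complex\<close> is only partial, but its nonnegative elements are
  real and closed under products.\<close>

lemma prod_complex_nonneg:
  fixes f :: "'a \<Rightarrow> complex"
  assumes "\<And>i. i \<in> I \<Longrightarrow> 0 \<le> f i"
  shows "0 \<le> prod f I"
proof -
  have "(0 :: complex) \<le> 1" by (simp add: less_eq_complex_def)
  then show ?thesis using assms by (induction I rule: infinite_finite_induct) auto
qed

text \<open>For each fixed history the probabilities of the next outcome sum to 1, so the last copy
  can be summed away and induction applies.\<close>

lemma sum_record_prob:
  assumes "\<And>j h. j < m \<Longrightarrow> h \<in> records N j \<Longrightarrow> (\<Sum>x<N. trace (A h x * s j)) = 1"
  shows "(\<Sum>xs\<in>records N m. record_prob A s xs) = 1"
  using assms
proof (induction m)
  case 0
  then show ?case by (simp add: records_0 record_prob_def)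
next
  case (Suc m)
  have "(\<Sum>xs\<in>records N (Suc m). record_prob A s xs) =
      (\<Sum>h\<in>records N m. record_prob A s h * (\<Sum>x<N. trace (A h x * s (length h))))"
    by (simp add: sum_records_Suc record_prob_snoc sum_distrib_left)
  also have "\<dots> = (\<Sum>h\<in>records N m. record_prob A s h)"
    using Suc.prems[of m] by (intro sum.cong refl) (simp add: records_def)
  also have "\<dots> = 1" using Suc by simp
  finally show ?case .
qed

lemma trace_record_effect:
  assumes "length xs = length Bs" and "\<forall>B \<in> set Bs. B \<in> carrier_mat D D"
    and "\<And>j. j < length xs \<Longrightarrow> A (take j xs) (xs ! j) \<in> carrier_mat D D"
  shows "trace (record_effect A xs * kron_list Bs) = record_prob A (\<lambda>j. Bs ! j) xs"
proof -
  have "trace (record_effect A xs * kron_list Bs) =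
     (\<Prod>j<length (map (\<lambda>j. A (take j xs) (xs ! j)) [0..<length xs]).
        trace (map (\<lambda>j. A (take j xs) (xs ! j)) [0..<length xs] ! j * Bs ! j))"
    unfolding record_effect_def using assms by (intro trace_kron_list_mult) auto
  then show ?thesis by (simp add: record_prob_def)
qed


section \<open>Change points\<close>

locale change_point =
  fixes ds d \<psi> Smutd M
  assumes problem: "change_point_problem ds d \<psi> Smutd M"
begin

abbreviation "D \<equiv> prod_list ds"

definition "\<sigma> = (1 / (of_nat d - 1)) \<cdot>\<^sub>m sum_ket_bra D Smutd"

text \<open>Copies are numbered from 0, so exactly the copies \<open>0, ..., k - 1\<close> precede
  change point \<open>k\<close>.\<close>

definition "copy_state k j = (if j < k then ket_bra \<psi> else \<sigma>)"

lemma psi_carrier: "\<psi> \<in> carrier_vec D"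
  and Smutd_carrier: "Smutd \<subseteq> carrier_vec D"
  and psi_norm: "\<psi> \<bullet>c \<psi> = 1"
  and Smutd_norm: "\<phi> \<in> Smutd \<Longrightarrow> \<phi> \<bullet>c \<phi> = 1"
  and psi_notin: "\<psi> \<notin> Smutd"
  and finite_Smutd: "finite Smutd"
  and orthonormal_Smutd: "orthonormal_set D Smutd"
  and M_pos: "1 \<le> M"
  using problem by (auto simp: change_point_problem_def orthonormal_set_def)

text \<open>The subtraction in \<open>card Smutd = d - 1\<close> is on naturals, the one in the
  normalisation of the mixture is on complex numbers; \<open>2 \<le> d\<close> reconciles them and
  excludes division by zero.\<close>

lemma card_Smutd: "of_nat (card Smutd) = (of_nat d - 1 :: complex)" and card_pos: "0 < card Smutd"
  using problem by (auto simp: change_point_problem_def of_nat_diff)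

lemma sigma_carrier: "\<sigma> \<in> carrier_mat D D"
  by (simp add: \<sigma>_def sum_ket_bra_def)

lemma copy_state_carrier: "copy_state k j \<in> carrier_mat D D"
  by (simp add: copy_state_def sigma_carrier ket_bra_carrier psi_carrier)

lemma trace_mult_psi: "E \<in> carrier_mat D D \<Longrightarrow> trace (E * ket_bra \<psi>) = expect E \<psi>"
  by (rule trace_mult_ket_bra[OF _ psi_carrier])

lemma trace_mult_sigma:
  "E \<in> carrier_mat D D \<Longrightarrow> trace (E * \<sigma>) = (\<Sum>\<phi>\<in>Smutd. expect E \<phi>) / of_nat (card Smutd)"
  unfolding \<sigma>_def card_Smutd by (simp add: trace_mult_sum_ket_bra Smutd_carrier)

text \<open>For \<open>\<psi>\<close> this is its norm; for the mixture it is the average of the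
  norms of the mutants.\<close>

lemma sum_trace_copy_state:
  assumes "povm D N E"
  shows "(\<Sum>x<N. trace (E x * copy_state k j)) = 1"
proof -
  have "(\<Sum>x<N. trace (E x * ket_bra \<psi>)) = 1"
    using sum_expect_povm[OF assms psi_carrier]
    by (simp add: trace_mult_psi povm_carrier[OF assms] psi_norm)
  moreover have "(\<Sum>x<N. trace (E x * \<sigma>)) = 1"
  proof -
    have "(\<Sum>x<N. trace (E x * \<sigma>)) = (\<Sum>x<N. \<Sum>\<phi>\<in>Smutd. expect (E x) \<phi>) / of_nat (card Smutd)"
      by (simp add: trace_mult_sigma povm_carrier[OF assms] sum_divide_distrib)
    also have "(\<Sum>x<N. \<Sum>\<phi>\<in>Smutd. expect (E x) \<phi>) = (\<Sum>\<phi>\<in>Smutd. \<Sum>x<N. expect (E x) \<phi>)"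
      by (rule sum.swap)
    also have "\<dots> = (\<Sum>\<phi>\<in>Smutd. 1)"
      using Smutd_carrier by (intro sum.cong refl) (auto simp: sum_expect_povm[OF assms] Smutd_norm)
    finally show ?thesis using card_pos by simp
  qed
  ultimately show ?thesis by (simp add: copy_state_def)
qed

lemma trace_copy_state_nonneg:
  assumes "povm D N E" and "x < N"
  shows "0 \<le> trace (E x * copy_state k j)"
proof -
  have "0 \<le> (\<Sum>\<phi>\<in>Smutd. expect (E x) \<phi>)"
    using Smutd_carrier by (auto intro!: sum_nonneg povm_expect_nonneg[OF assms])
  then show ?thesis
    using povm_expect_nonneg[OF assms psi_carrier]
    by (auto simp: copy_state_def trace_mult_psi trace_mult_sigma povm_carrier[OF assms]
        less_eq_complex_def)
qed

lemma change_point_state_eq: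
  assumes "k \<le> M"
  shows "change_point_state D d \<psi> Smutd M k = kron_list (map (copy_state k) [0..<M])"
proof -
  have "replicate k (ket_bra \<psi>) @ replicate (M - k) \<sigma> = map (copy_state k) [0..<M]"
    using assms by (intro nth_equalityI) (auto simp: nth_append copy_state_def)
  then show ?thesis
    by (simp add: change_point_state_def \<sigma>_def
        orth_proj_eq_sum_ket_bra[OF finite_Smutd orthonormal_Smutd])
qed

text \<open>The bridge from the \<open>M\<close>-copy definition of success to
  \<open>record_prob\<close>. Prefixes of a record are records, so every effect met along it belongs
  to a POVM.\<close>

lemma trace_record_effect_change_point_state:
  assumes "\<And>m h. m < M \<Longrightarrow> h \<in> records N m \<Longrightarrow> povm D N (A h)"
    and "k \<le> M" and "xs \<in> records N M"
  shows "trace (record_effect A xs * change_point_state D d \<psi> Smutd M k) = record_prob A (copy_state k) xs"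
proof -
  have len: "length xs = M" using assms(3) by (simp add: records_def)
  have "A (take j xs) (xs ! j) \<in> carrier_mat D D" if "j < M" for j
    using that assms(1)[of j "take j xs"] records_take[OF assms(3), of j] records_nth[OF assms(3), of j]
    by (auto intro: povm_carrier)
  then have "trace (record_effect A xs * kron_list (map (copy_state k) [0..<M])) =
      record_prob A (\<lambda>j. map (copy_state k) [0..<M] ! j) xs"
    using len by (intro trace_record_effect[of _ _ D]) (auto simp: copy_state_carrier)
  then show ?thesis
    using len by (simp add: change_point_state_eq[OF assms(2)] record_prob_def)
qed

section \<open>From authentication to an adaptive strategy\<close>

lemma solvable_if_answered:
  assumes "perfectly_answered ds (insert \<psi> Smutd) \<psi>"
  shows "adaptively_locally_solvable ds d \<psi> Smutd M"
proof -
  obtain E where E: "locc_implementable ds 2 E" "expect (E 1) \<psi> = 1"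
    and E0: "\<And>\<phi>. \<phi> \<in> Smutd \<Longrightarrow> expect (E 1) \<phi> = 0"
    using assms psi_notin by (auto simp: perfectly_answered_def)
  have povm: "povm D 2 E" using E by (simp add: locc_implementable_def)
  have E1: "trace (E (Suc 0) * copy_state k j) = (if j < k then 1 else 0)" for k j
    using E E0
    by (simp add: copy_state_def trace_mult_psi trace_mult_sigma povm_carrier[OF povm])
  \<comment> \<open>With two outcomes, completeness makes outcome 0 certain on every copy after the
    change.\<close>
  have E_0: "trace (E 0 * copy_state k j) = (if j < k then 0 else 1)" for k j
    using sum_trace_copy_state[OF povm, of k j] by (auto simp: numeral_2_eq_2 E1 split: if_splits)
  \<comment> \<open>The announced change point is the length of the initial run of ones, which on
    \<open>?xs k\<close> is \<open>k\<close>, including the extreme cases \<open>k = 0\<close> and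
    \<open>k = M\<close>.\<close>
  let ?guess = "\<lambda>xs. length (takeWhile (\<lambda>x. x = 1) xs)"
  let ?xs = "\<lambda>k. replicate k (1::nat) @ replicate (M - k) 0"
  \<comment> \<open>Every factor of the record probability is 0 or 1, so the distribution is
    concentrated on \<open>?xs k\<close>.\<close>
  have prob: "record_prob (\<lambda>h. E) (copy_state k) xs = (if xs = ?xs k then 1 else 0)"
    if "k \<le> M" "xs \<in> records 2 M" for k xs
  proof -
    have len: "length xs = M" using that by (simp add: records_def)
    have factor: "trace (E (xs ! j) * copy_state k j) = (if xs ! j = ?xs k ! j then 1 else 0)"
      if "j < M" for j
    proof -
      have "xs ! j = 0 \<or> xs ! j = 1"
        using records_nth[OF \<open>xs \<in> records 2 M\<close> that] by auto
      then show ?thesis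
        using E1[of k j] E_0[of k j] that by (auto simp: nth_append)
    qed
    have "record_prob (\<lambda>h. E) (copy_state k) xs = (\<Prod>j<M. if xs ! j = ?xs k ! j then 1 else 0)"
      unfolding record_prob_def len by (intro prod.cong refl factor) simp
    also have "\<dots> = (if \<forall>j<M. xs ! j = ?xs k ! j then 1 else 0)"
      by (auto intro!: prod.neutral)
    also have "(\<forall>j<M. xs ! j = ?xs k ! j) \<longleftrightarrow> xs = ?xs k"
      using len that by (auto simp: list_eq_iff_nth_eq)
    finally show ?thesis .
  qed
  have "(\<Sum>xs \<in> {xs \<in> records 2 M. ?guess xs = k}.
      trace (record_effect (\<lambda>h. E) xs * change_point_state D d \<psi> Smutd M k)) = 1" if "k \<le> M" for k
  proof -
    have "?xs k \<in> {xs \<in> records 2 M. ?guess xs = k}"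
      using that by (auto simp: records_def takeWhile_append takeWhile_replicate)
    moreover have "(\<Sum>xs \<in> {xs \<in> records 2 M. ?guess xs = k}.
        trace (record_effect (\<lambda>h. E) xs * change_point_state D d \<psi> Smutd M k)) =
      (\<Sum>xs \<in> {xs \<in> records 2 M. ?guess xs = k}. if xs = ?xs k then 1 else 0)"
      using that povm
      by (intro sum.cong refl) (auto simp: trace_record_effect_change_point_state[of 2] prob)
    ultimately show ?thesis by (simp add: finite_records)
  qed
  with E(1) show ?thesis
    unfolding adaptively_locally_solvable_def
    by (intro exI[of _ 2] exI[of _ "\<lambda>h. E"] exI[of _ ?guess]) simp
qed

section \<open>From an adaptive strategy to authentication\<close>

lemma answered_if_solvable:
  assumes "adaptively_locally_solvable ds d \<psi> Smutd M"
  shows "perfectly_answered ds (insert \<psi> Smutd) \<psi>"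
proof -
  obtain N A guess where locc: "\<And>m h. m < M \<Longrightarrow> h \<in> records N m \<Longrightarrow> locc_implementable ds N (A h)"
    and correct: "\<And>k. k \<le> M \<Longrightarrow> (\<Sum>xs \<in> {xs \<in> records N M. guess xs = k}.
            trace (record_effect A xs * change_point_state D d \<psi> Smutd M k)) = 1"
    using assms unfolding adaptively_locally_solvable_def by blast
  have povm: "povm D N (A h)" if "m < M" "h \<in> records N m" for m h
    using locc[OF that] by (simp add: locc_implementable_def)
  let ?p = "\<lambda>k. record_prob A (copy_state k)"
  have right: "(\<Sum>xs \<in> {xs \<in> records N M. guess xs = k}. ?p k xs) = 1" if "k \<le> M" for k
    unfolding correct[OF that, symmetric]
    using that by (intro sum.cong refl) (simp add: trace_record_effect_change_point_state[OF povm])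
  have nonneg: "0 \<le> ?p k xs" if "xs \<in> records N M" for k xs
    unfolding record_prob_def using that
    by (intro prod_complex_nonneg trace_copy_state_nonneg[OF povm[OF _ records_take[OF that]]] records_nth[OF that])
      (auto simp: records_def)
  \<comment> \<open>All records together have probability 1 and so do those with the correct guess;
    the remaining nonnegative terms sum to 0.\<close>
  have wrong: "?p k xs = 0" if "k \<le> M" "xs \<in> records N M" "guess xs \<noteq> k" for k xs
  proof -
    let ?W = "{xs \<in> records N M. guess xs \<noteq> k}"
    have "(\<Sum>xs\<in>records N M. ?p k xs) = (\<Sum>xs \<in> {xs \<in> records N M. guess xs = k}. ?p k xs) + (\<Sum>xs\<in>?W. ?p k xs)"
      using finite_records by (subst sum.union_disjoint[symmetric]) (auto intro!: sum.cong)
    moreover have "(\<Sum>xs\<in>records N M. ?p k xs) = 1"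
      by (intro sum_record_prob sum_trace_copy_state povm)
    ultimately have "(\<Sum>xs\<in>?W. ?p k xs) = 0"
      using right[OF that(1)] by simp
    then show ?thesis
      using that nonneg finite_records by (subst (asm) sum_nonneg_eq_0_iff) auto
  qed
  obtain m where m: "M = Suc m" using M_pos by (cases M) auto
  have "\<exists>xs \<in> records N M. ?p M xs \<noteq> 0"
  proof (rule ccontr)
    assume "\<not> ?thesis"
    then have "(\<Sum>xs \<in> {xs \<in> records N M. guess xs = M}. ?p M xs) = 0"
      by (intro sum.neutral) auto
    with right[of M] show False by simp
  qed
  then obtain xs where xs: "xs \<in> records N M" "?p M xs \<noteq> 0" by blast
  define h where "h = take m xs"
  have h: "h \<in> records N m" "length h = m"
    using records_take[OF xs(1), of m] by (auto simp: h_def m records_def)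
  \<comment> \<open>These are the first \<open>m\<close> factors of the nonzero product
    \<open>?p M xs\<close>; only the last outcome of \<open>xs\<close> is discarded.\<close>
  have h_pos: "(\<Prod>j<m. trace (A (take j h) (h ! j) * ket_bra \<psi>)) \<noteq> 0"
    using xs m by (auto simp: record_prob_def copy_state_def h_def records_def min_def)
  \<comment> \<open>For \<open>m \<le> k\<close> the first \<open>m\<close> copies are all in state
    \<open>\<psi>\<close>, so change points \<open>m\<close> and \<open>M = Suc m\<close> give
    \<open>h\<close> the same probability.\<close>
  have prob_h: "record_prob A (copy_state k) h = (\<Prod>j<m. trace (A (take j h) (h ! j) * ket_bra \<psi>))"
    if "m \<le> k" for k
    using that h by (simp add: record_prob_def copy_state_def)
  have povm_h: "povm D N (A h)" using povm[of m] h m by simp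
  note carrier = povm_carrier[OF povm_h]
  define f where "f x = (if guess (h @ [x]) = M then 1 else 0 :: nat)" for x
  define E where "E = coarsen D N f (A h)"
  have implementable: "locc_implementable ds 2 E"
    unfolding E_def using locc[of m h] h m by (intro locc_implementable_coarsen) (auto simp: f_def)
  \<comment> \<open>The record \<open>h @ [x]\<close> is wrong for \<open>k\<close> and has
    probability 0, while its factor belonging to \<open>h\<close> is nonzero. The last copy,
    numbered \<open>m\<close>, is in state \<open>\<psi>\<close> for \<open>k = M\<close> and in
    state \<open>\<sigma>\<close> for \<open>k = m\<close>.\<close>
  have last: "trace (A h x * copy_state k m) = 0"
    if "x < N" "guess (h @ [x]) \<noteq> k" "m \<le> k" "k \<le> M" for x k
    using wrong[of k "h @ [x]"] that h h_pos m by (auto simp: records_snoc record_prob_snoc prob_h)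
  have on_psi: "expect (E 1) \<psi> = 1"
  proof -
    have "expect (E 1) \<psi> = (\<Sum>x | x < N \<and> f x = 1. expect (A h x) \<psi>)"
      unfolding E_def by (intro expect_coarsen carrier psi_carrier)
    \<comment> \<open>Outcomes with label 0 announce something other than \<open>M\<close>, hence
      never occur on \<open>\<psi>\<close>, and may be added to the sum.\<close>
    also have "\<dots> = (\<Sum>x<N. expect (A h x) \<psi>)"
    proof (rule sum.mono_neutral_left)
      show "\<forall>x \<in> {..<N} - {x. x < N \<and> f x = 1}. expect (A h x) \<psi> = 0"
        using last[of _ M] m
        by (auto simp: f_def copy_state_def trace_mult_psi carrier split: if_splits)
    qed auto
    also have "\<dots> = 1"
      using sum_expect_povm[OF povm_h psi_carrier] psi_norm by simp
    finally show ?thesis .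
  qed
  have "expect (E 1) \<phi> = 0" if "\<phi> \<in> Smutd" for \<phi>
  proof -
    have "expect (A h x) \<phi> = 0" if x: "x < N" "f x = 1" for x
    proof -
      \<comment> \<open>Announcing \<open>M\<close> is an error when the change point is
        \<open>m\<close>, so such an outcome has probability 0 on the mixture; its terms are
        nonnegative, so it has probability 0 on each mutant.\<close>
      have "guess (h @ [x]) \<noteq> m" using x m by (auto simp: f_def split: if_splits)
      then have "(\<Sum>\<phi>\<in>Smutd. expect (A h x) \<phi>) = 0"
        using last[of x m] x m card_pos by (auto simp: copy_state_def trace_mult_sigma carrier)
      then show ?thesis
        using \<open>\<phi> \<in> Smutd\<close> finite_Smutd Smutd_carrier povm_expect_nonneg[OF povm_h x(1)]
        by (subst (asm) sum_nonneg_eq_0_iff) auto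
    qed
    moreover have "\<phi> \<in> carrier_vec D" using that Smutd_carrier by auto
    ultimately show ?thesis
      unfolding E_def by (simp add: expect_coarsen carrier)
  qed
  with implementable on_psi show ?thesis
    unfolding perfectly_answered_def by (intro exI[of _ E]) auto
qed

end

theorem theorem5:
  fixes n d M :: nat
    and ds :: "nat list"
    and \<psi> :: "complex vec"
    and Smutd :: "complex vec set"
  assumes "2 \<le> n" and "length ds = n"
    and "change_point_problem ds d \<psi> Smutd M"
  shows "adaptively_locally_solvable ds d \<psi> Smutd M \<longleftrightarrow>
         perfectly_answered ds (insert \<psi> Smutd) \<psi>"
proof -
  interpret change_point ds d \<psi> Smutd M
    by unfold_locales (rule assms(3))
  show ?thesis
    using solvable_if_answered answered_if_solvable by blast
qed

end
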